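(* Let $X$ be a non-empty set and let $f: X\to X$ be a map such that $f(x_0)\neq x_0$ for some $x_0\in X$. Then $f$ has no iterative square root in $\mathcal{F}(X)$ (i.e. there is no map $g:X\to X$ with $g\circ g=f$) in each of the following cases: Case (i): $\# f^{-2}(x_0)>1$, and $\# f^{-1}(x)\le 1$ for all $x\neq x_0$; Case (ii): $f^{-2}(x_0)$ is infinite, and $f^{-1}(x)$ is finite for all $x\neq x_0$; Case (iii): $f^{-2}(x_0)$ is uncountable, and $f^{-1}(x)$ is countable for all $x\neq x_0$.
   Context: $\mathcal{F}(X)$ denotes the set of all self-maps of $X$ (no topology or continuity is assumed). For $x\in X$, $f^{-1}(x)=\{y\in X: f(y)=x\}$ and $f^{-2}(x)=\{y\in X: f(f(y))=x\}$. $\#A$ denotes the cardinality of a set $A$. *)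

theory Defs
  imports Main "HOL-Library.FuncSet" "HOL-Library.Countable_Set"
begin

text \<open>
  A self-map of \<open>X\<close> is represented by its unique extensional extension to the whole type, so that
  equality of self-maps is HOL equality and composition is \<^const>\<open>compose\<close>.
\<close>

definition self_maps :: "'a set \<Rightarrow> ('a \<Rightarrow> 'a) set"
  where "self_maps X = X \<rightarrow>\<^sub>E X"

definition has_iterative_square_root :: "'a set \<Rightarrow> ('a \<Rightarrow> 'a) \<Rightarrow> bool"
  where "has_iterative_square_root X f \<longleftrightarrow> (\<exists>g \<in> self_maps X. compose X g g = f)"

definition preimage1 :: "'a set \<Rightarrow> ('a \<Rightarrow> 'a) \<Rightarrow> 'a \<Rightarrow> 'a set"
  where "preimage1 X f x = {y \<in> X. f y = x}"

definition preimage2 :: "'a set \<Rightarrow> ('a \<Rightarrow> 'a) \<Rightarrow> 'a \<Rightarrow> 'a set"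
  where "preimage2 X f x = {y \<in> X. f (f y) = x}"

text \<open>Finiteness is required because \<^const>\<open>card\<close> is \<open>0\<close> on infinite sets.\<close>

definition at_most_one :: "'b set \<Rightarrow> bool"
  where "at_most_one A \<longleftrightarrow> finite A \<and> card A \<le> 1"

definition more_than_one :: "'b set \<Rightarrow> bool"
  where "more_than_one A \<longleftrightarrow> infinite A \<or> card A > 1"

end

theory Submission
  imports Defs
begin

text \<open>
  Let \<open>g\<close> be a square root of \<open>f\<close> and \<open>S = f\<^sup>-\<^sup>2(x\<^sub>0)\<close>, so that \<open>g\<^sup>4\<close> sends \<open>S\<close> to \<open>x\<^sub>0\<close>, and
  \<open>g(x\<^sub>0) \<noteq> x\<^sub>0\<close>. Call a set small if it has at most one element, is finite, or is countable,
  according to the case. As \<open>f \<circ> g\<^sup>3 = g \<circ> g\<^sup>4\<close>, the set \<open>g\<^sup>3(S)\<close> lies in the small fibre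
  \<open>f\<^sup>-\<^sup>1(g(x\<^sub>0))\<close>. It avoids \<open>x\<^sub>0\<close>, so \<open>g(S)\<close>, which \<open>f\<close> maps to \<open>g\<^sup>3(S)\<close>, is a small union of
  small fibres. Hence \<open>f(S) = g(g(S))\<close> is small; it avoids \<open>x\<^sub>0\<close> because \<open>f\<close> maps it to \<open>x\<^sub>0\<close>, so
  \<open>S\<close> too is a small union of small fibres.
\<close>

lemma small_preimage2_if_square_root:
  fixes small :: "'a set \<Rightarrow> bool"
  assumes sub: "\<And>A B. small B \<Longrightarrow> A \<subseteq> B \<Longrightarrow> small A"
    and img: "\<And>h A. small A \<Longrightarrow> small (h ` A)"
    and UN: "\<And>A F. small A \<Longrightarrow> (\<And>a. a \<in> A \<Longrightarrow> small (F a)) \<Longrightarrow> small (\<Union>a\<in>A. F a)"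
    and x0: "x0 \<in> X" "f x0 \<noteq> x0"
    and fib: "\<And>x. x \<in> X \<Longrightarrow> x \<noteq> x0 \<Longrightarrow> small (preimage1 X f x)"
    and root: "has_iterative_square_root X f"
  shows "small (preimage2 X f x0)"
proof -
  obtain g where "g \<in> X \<rightarrow>\<^sub>E X" and f: "f = compose X g g"
    using root unfolding has_iterative_square_root_def self_maps_def by blast
  then have gX: "g y \<in> X" if "y \<in> X" for y
    using that by auto
  have f: "f y = g (g y)" if "y \<in> X" for y
    using that f by (simp add: compose_eq)
  \<comment> \<open>A fixed point of \<open>g\<close> is also one of \<open>f\<close>.\<close>
  have g0: "g x0 \<noteq> x0"
    using x0 f by force
  define S where "S = preimage2 X f x0"
  have S: "y \<in> X" "g (g (g (g y))) = x0" if "y \<in> S" for y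
    using that by (auto simp: S_def preimage2_def f gX)
  have "(\<lambda>y. g (g (g y))) ` S \<subseteq> preimage1 X f (g x0)"
    using S by (auto simp: preimage1_def f gX)
  then have g3: "small ((\<lambda>y. g (g (g y))) ` S)"
    using sub fib gX g0 x0(1) by blast
  \<comment> \<open>\<open>fib\<close> applies: if \<open>g (g (g y)) = x0\<close>, one more
    \<open>g\<close> gives \<open>x0 = g x0\<close>, against \<open>g0\<close>.\<close>
  have "small (\<Union>y\<in>(\<lambda>y. g (g (g y))) ` S. preimage1 X f y)"
    using S g0 by (intro UN[OF g3] fib) (auto simp: gX)
  moreover have "g ` S \<subseteq> (\<Union>y\<in>(\<lambda>y. g (g (g y))) ` S. preimage1 X f y)"
    using S by (auto simp: preimage1_def f gX)
  ultimately have "small (g ` S)"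
    by (rule sub)
  then have g2: "small (g ` g ` S)"
    by (rule img)
  have "g (g y) \<noteq> x0" if "y \<in> S" for y
    using S[OF that] x0 f by metis
  then have "small (\<Union>y\<in>g ` g ` S. preimage1 X f y)"
    using S by (intro UN[OF g2] fib) (auto simp: gX)
  moreover have "S \<subseteq> (\<Union>y\<in>g ` g ` S. preimage1 X f y)"
    using S by (auto simp: preimage1_def f)
  ultimately show ?thesis
    unfolding S_def by (rule sub)
qed

text \<open>Trades cardinality for an inclusion, from which closure under subsets, images and unions
  is easy to read off.\<close>

lemma at_most_one_iff_subset_singleton: "at_most_one A \<longleftrightarrow> (\<exists>a. A \<subseteq> {a})"
proof
  assume "at_most_one A"
  then show "\<exists>a. A \<subseteq> {a}"
    by (auto simp: at_most_one_def le_Suc_eq card_1_singleton_iff)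
next
  assume "\<exists>a. A \<subseteq> {a}"
  then show "at_most_one A"
    by (auto simp: at_most_one_def subset_singleton_iff)
qed

lemma more_than_one_iff_not_at_most_one: "more_than_one A \<longleftrightarrow> \<not> at_most_one A"
  by (auto simp: more_than_one_def at_most_one_def)

theorem theorem2p4:
  fixes X :: "'a set" and f :: "'a \<Rightarrow> 'a" and x0 :: 'a
  assumes "X \<noteq> {}"
    and "f \<in> self_maps X"
    and "x0 \<in> X"
    and "f x0 \<noteq> x0"
  shows "(more_than_one (preimage2 X f x0) \<and>
            (\<forall>x\<in>X. x \<noteq> x0 \<longrightarrow> at_most_one (preimage1 X f x))
          \<longrightarrow> \<not> has_iterative_square_root X f) \<and>
         (infinite (preimage2 X f x0) \<and>
            (\<forall>x\<in>X. x \<noteq> x0 \<longrightarrow> finite (preimage1 X f x))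
          \<longrightarrow> \<not> has_iterative_square_root X f) \<and>
         (uncountable (preimage2 X f x0) \<and>
            (\<forall>x\<in>X. x \<noteq> x0 \<longrightarrow> countable (preimage1 X f x))
          \<longrightarrow> \<not> has_iterative_square_root X f)"
proof (intro conjI impI notI; elim conjE)
  assume "more_than_one (preimage2 X f x0)"
    and "\<forall>x\<in>X. x \<noteq> x0 \<longrightarrow> at_most_one (preimage1 X f x)"
    and "has_iterative_square_root X f"
  \<comment> \<open>Such a union is empty or a single \<open>F a\<close>.\<close>
  moreover have "at_most_one (\<Union>a\<in>A. F a)"
    if "at_most_one A" "\<And>a. a \<in> A \<Longrightarrow> at_most_one (F a)" for A :: "'a set" and F :: "'a \<Rightarrow> 'a set"
    using that by (force simp: at_most_one_iff_subset_singleton subset_singleton_iff)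
  moreover have "at_most_one (h ` A)" if "at_most_one A" for A :: "'a set" and h :: "'a \<Rightarrow> 'a"
    using that by (auto simp: at_most_one_iff_subset_singleton)
  moreover have "at_most_one A" if "at_most_one B" "A \<subseteq> B" for A B :: "'a set"
    using that by (auto simp: at_most_one_iff_subset_singleton)
  ultimately show False
    using small_preimage2_if_square_root[of at_most_one x0 X f] assms
    by (simp add: more_than_one_iff_not_at_most_one)
next
  assume "infinite (preimage2 X f x0)"
    and "\<forall>x\<in>X. x \<noteq> x0 \<longrightarrow> finite (preimage1 X f x)"
    and "has_iterative_square_root X f"
  then show False
    using small_preimage2_if_square_root[of finite x0 X f] assms
    by (simp add: finite_subset)
next
  assume "uncountable (preimage2 X f x0)"
    and "\<forall>x\<in>X. x \<noteq> x0 \<longrightarrow> countable (preimage1 X f x)"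
    and "has_iterative_square_root X f"
  \<comment> \<open>Closure under unions is here the countability of a countable union of countable
    sets.\<close>
  then show False
    using small_preimage2_if_square_root[of countable x0 X f] assms
    by (simp add: countable_subset)
qed

end
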